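(* Let $n>k\ge 0$ be integers such that $kn$ is even, and let $\mathbf{k^n}$ denote the degree sequence $(k,\dots,k)$ of length $n$. Then $\overline{\mu}(\mathbf{k^n})=k$, unless $k=2$ and $n$ is odd, or $k=4$ and $n\in\{5,7\}$; in these exceptional cases $\overline{\mu}(\mathbf{k^n})=k-1$.
   Context: All graphs are finite and simple. For a graph $G=(V,E)$ on $n$ vertices, a fractional vertex cover is a function $f:V\to[0,\infty)$ with $f(u)+f(v)\ge 1$ for every edge $uv\in E$; $\tau^*(G)$ denotes the minimum of $\sum_{v\in V}f(v)$ over all fractional vertex covers. For $E'\subseteq E$ let $G-E'=(V,E\setminus E')$. Define $\mu(G)=\min\{|E'| : E'\subseteq E,\ \tau^*(G-E')<n/2\}$ (equivalently, the minimum number of edges whose deletion leaves no perfect 2-matching, i.e. no spanning subgraph each of whose components is a $K_2$ or an odd cycle). For a graphical degree sequence $\mathbf d$, $\overline{\mu}(\mathbf d)$ is the maximum of $\mu(G)$ over all simple graphs $G$ realizing $\mathbf d$. *)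

theory Defs
  imports Complex_Main
begin

definition simple_graph :: "nat \<Rightarrow> nat set set \<Rightarrow> bool" where
  "simple_graph n E \<longleftrightarrow> (\<forall>e\<in>E. \<exists>u v. e = {u, v} \<and> u \<noteq> v \<and> u < n \<and> v < n)"

definition degree :: "nat set set \<Rightarrow> nat \<Rightarrow> nat" where
  "degree E v = card {e\<in>E. v \<in> e}"

definition frac_vertex_cover :: "nat \<Rightarrow> nat set set \<Rightarrow> (nat \<Rightarrow> real) \<Rightarrow> bool" where
  "frac_vertex_cover n E f \<longleftrightarrow>
     (\<forall>v<n. f v \<ge> 0) \<and> (\<forall>u v. {u, v} \<in> E \<longrightarrow> f u + f v \<ge> 1)"

definition tau_star :: "nat \<Rightarrow> nat set set \<Rightarrow> real" where
  "tau_star n E = Inf {(\<Sum>v<n. f v) | f. frac_vertex_cover n E f}"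

definition mu :: "nat \<Rightarrow> nat set set \<Rightarrow> nat" where
  "mu n E = (LEAST m. \<exists>E'. E' \<subseteq> E \<and> card E' = m \<and> tau_star n (E - E') < real n / 2)"

definition mu_bar :: "nat \<Rightarrow> (nat \<Rightarrow> nat) \<Rightarrow> nat" where
  "mu_bar n d = Max {mu n E | E. simple_graph n E \<and> (\<forall>v<n. degree E v = d v)}"

end

theory Submission
  imports Defs
begin

text \<open>Rounding a fractional cover at a suitable threshold shows that \<open>\<tau>\<^sup>* < n / 2\<close> means that some
  independent \<open>S\<close> has its neighbourhood in a set \<open>T\<close> with \<open>card S = card T + 1\<close>. In a \<open>k\<close>-regular graph,
  producing this for given disjoint \<open>S, T\<close> costs exactly \<open>(k + 2 e(T) + e(R, S \<union> T)) / 2\<close> edge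
  deletions, where \<open>R\<close> is the set of remaining vertices. So \<open>\<mu> = k\<close> as soon as the graph is
  \<open>k\<close>-edge-connected and, for odd \<open>n\<close>, every set of \<open>(n - 1) / 2\<close> vertices spans at least \<open>k / 2\<close>
  edges. The circulant graph with jumps \<open>1, \<dots>, k div 2\<close> (and \<open>n / 2\<close> for odd \<open>k\<close>) has both
  properties outside the exceptional cases; in those, every realization has a cheaper pair
  \<open>S, T\<close>.\<close>

section \<open>Level sets and fractional vertex covers\<close>

text \<open>The integral over \<open>t > 0\<close> of the difference of the two counts is the sum of
  \<open>g\<close>. The induction makes this discrete: if the smallest nonzero
  \<open>\<bar>g v\<bar>\<close> fails as threshold, moving all nonzero values towards 0 by that
  amount does not raise the sum and creates a new zero.\<close>

lemma level_set_deficit: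
  fixes g :: "'a \<Rightarrow> real"
  assumes "finite V" "sum g V < 0"
  shows "\<exists>t>0. card {v\<in>V. t \<le> g v} < card {v\<in>V. g v \<le> - t}"
  using assms(2)
proof (induction "card {v\<in>V. g v \<noteq> 0}" arbitrary: g rule: less_induct)
  case less
  define Z where "Z = {v\<in>V. g v \<noteq> 0}"
  have finZ: "finite Z"
    using assms(1) by (simp add: Z_def)
  have "Z \<noteq> {}"
  proof
    assume "Z = {}"
    then have "sum g V = 0"
      by (intro sum.neutral) (auto simp: Z_def)
    with less.prems show False by simp
  qed
  define t where "t = Min ((\<lambda>v. \<bar>g v\<bar>) ` Z)"
  have t_le: "t \<le> \<bar>g v\<bar>" if "v \<in> V" "g v \<noteq> 0" for v
    using finZ that by (auto simp: t_def Z_def)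
  have "t \<in> (\<lambda>v. \<bar>g v\<bar>) ` Z"
    unfolding t_def using finZ \<open>Z \<noteq> {}\<close> by (intro Min_in) auto
  then obtain z where z: "z \<in> V" "g z \<noteq> 0" "t = \<bar>g z\<bar>"
    by (auto simp: Z_def)
  then have "t > 0" by simp
  let ?P = "{v\<in>V. t \<le> g v}" and ?N = "{v\<in>V. g v \<le> - t}"
  show ?case
  proof (cases "card ?P < card ?N")
    case True
    with \<open>t > 0\<close> show ?thesis by blast
  next
    case False
    define h where
      "h v = g v - t * of_bool (t \<le> g v) + t * of_bool (g v \<le> - t)" for v
    have "sum h V = sum g V - t * real (card ?P) + t * real (card ?N)"
      using assms(1)
      by (simp add: h_def sum.distrib sum_subtractf sum_distrib_left[symmetric]
          Int_def)
    also have "\<dots> \<le> sum g V"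
      using False \<open>t > 0\<close> by simp
    finally have "sum h V < 0"
      using less.prems by simp
    moreover have "card {v\<in>V. h v \<noteq> 0} < card {v\<in>V. g v \<noteq> 0}"
    proof (rule psubset_card_mono)
      have "z \<notin> {v\<in>V. h v \<noteq> 0}"
        using z by (auto simp: h_def)
      moreover have "{v\<in>V. h v \<noteq> 0} \<subseteq> {v\<in>V. g v \<noteq> 0}"
        using \<open>t > 0\<close> by (auto simp: h_def)
      ultimately show "{v\<in>V. h v \<noteq> 0} \<subset> {v\<in>V. g v \<noteq> 0}"
        using z by blast
    qed (use assms(1) in auto)
    ultimately obtain s where s: "s > 0" "card {v\<in>V. s \<le> h v} < card {v\<in>V. h v \<le> - s}"
      using less.hyps by blast
    \<comment> \<open>By minimality of \<open>t\<close>, no value of \<open>g\<close> lies strictly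
      between 0 and \<open>t\<close> in modulus, so the level sets of \<open>h\<close> at
      \<open>s\<close> are those of \<open>g\<close> at \<open>s + t\<close>.\<close>
    have "(s \<le> h v \<longleftrightarrow> s + t \<le> g v) \<and> (h v \<le> - s \<longleftrightarrow> g v \<le> - (s + t))" if "v \<in> V" for v
    proof -
      consider "t \<le> g v" | "g v \<le> - t" | "g v = 0"
        using t_le[of v] \<open>v \<in> V\<close> by linarith
      then show ?thesis
        by cases (use s(1) \<open>t > 0\<close> in \<open>auto simp: h_def\<close>)
    qed
    then have "{v\<in>V. s \<le> h v} = {v\<in>V. s + t \<le> g v}" "{v\<in>V. h v \<le> - s} = {v\<in>V. g v \<le> - (s + t)}"
      by auto
    with s \<open>t > 0\<close> show ?thesis
      by (intro exI[of _ "s + t"]) auto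
  qed
qed

lemma simple_graph_subset: "simple_graph n E \<Longrightarrow> F \<subseteq> E \<Longrightarrow> simple_graph n F"
  by (auto simp: simple_graph_def)

lemma simple_graph_edge:
  assumes "simple_graph n E" "{u, v} \<in> E"
  shows "u < n" "v < n" "u \<noteq> v"
proof -
  obtain a b where "{u, v} = {a, b}" "a \<noteq> b" "a < n" "b < n"
    using assms unfolding simple_graph_def by blast
  then show "u < n" "v < n" "u \<noteq> v"
    by (auto simp: doubleton_eq_iff)
qed

lemma simple_graph_finite:
  assumes "simple_graph n E"
  shows "finite E"
proof (rule finite_subset)
  show "E \<subseteq> Pow {..<n}"
    using assms by (auto simp: simple_graph_def)
qed simp

text \<open>Apply the level sets to \<open>f - 1/2\<close>: if \<open>f u \<le> 1/2 - t\<close>,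
  each neighbour of \<open>u\<close> has value at least \<open>1/2 + t\<close>. Conversely, the
  cover with value 0 on \<open>S\<close>, 1 on \<open>T\<close> and 1/2 elsewhere has weight below
  \<open>n / 2\<close>.\<close>

lemma tau_star_less_half_iff:
  assumes "simple_graph n F"
  shows "tau_star n F < real n / 2 \<longleftrightarrow>
    (\<exists>S T. S \<subseteq> {..<n} \<and> T \<subseteq> {..<n} \<and> S \<inter> T = {} \<and> card T < card S \<and>
      (\<forall>u\<in>S. \<forall>v. {u, v} \<in> F \<longrightarrow> v \<in> T))" (is "?lhs \<longleftrightarrow> ?rhs")
proof
  assume ?lhs
  define X where "X = {(\<Sum>v<n. f v) | f. frac_vertex_cover n F f}"
  have "frac_vertex_cover n F (\<lambda>_. 1)"
    by (auto simp: frac_vertex_cover_def)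
  then have "X \<noteq> {}"
    by (auto simp: X_def)
  with \<open>?lhs\<close> obtain x where "x \<in> X" "x < real n / 2"
    unfolding tau_star_def X_def[symmetric] using cInf_lessD[of X] by blast
  then obtain f where f: "frac_vertex_cover n F f" "(\<Sum>v<n. f v) < real n / 2"
    by (auto simp: X_def)
  define g where "g v = f v - 1 / 2" for v
  have "sum g {..<n} < 0"
    using f(2) by (simp add: g_def sum_subtractf)
  then obtain t where t: "t > 0"
    "card {v\<in>{..<n}. t \<le> g v} < card {v\<in>{..<n}. g v \<le> - t}"
    using level_set_deficit by blast
  show ?rhs
  proof (intro exI conjI ballI allI impI)
    fix u v assume uv: "u \<in> {v\<in>{..<n}. g v \<le> - t}" "{u, v} \<in> F"
    have "f u + f v \<ge> 1" "v < n"
      using f(1) uv(2) simple_graph_edge[OF assms] by (auto simp: frac_vertex_cover_def)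
    with uv(1) show "v \<in> {v\<in>{..<n}. t \<le> g v}"
      by (auto simp: g_def)
  qed (use t in auto)
next
  assume ?rhs
  then obtain S T where ST: "S \<subseteq> {..<n}" "T \<subseteq> {..<n}" "S \<inter> T = {}" "card T < card S"
    "\<And>u v. u \<in> S \<Longrightarrow> {u, v} \<in> F \<Longrightarrow> v \<in> T"
    by blast
  define f :: "nat \<Rightarrow> real" where "f v = (1 + of_bool (v \<in> T) - of_bool (v \<in> S)) / 2" for v
  have "frac_vertex_cover n F f"
    unfolding frac_vertex_cover_def
  proof (intro conjI allI impI)
    fix u v assume e: "{u, v} \<in> F"
    then have "{v, u} \<in> F" by (simp add: insert_commute)
    with e ST(3) ST(5)[of u v] ST(5)[of v u] show "f u + f v \<ge> 1"
      by (auto simp: f_def)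
  qed (auto simp: f_def)
  then have "tau_star n F \<le> (\<Sum>v<n. f v)"
    unfolding tau_star_def
    by (intro cInf_lower bdd_belowI[of _ 0]) (auto simp: frac_vertex_cover_def intro!: sum_nonneg)
  also have "(\<Sum>v<n. f v) = (real n + real (card T) - real (card S)) / 2"
  proof -
    have "{..<n} \<inter> T = T" "{..<n} \<inter> S = S"
      using ST by auto
    then show ?thesis
      by (simp add: f_def sum_divide_distrib[symmetric] sum.distrib sum_subtractf)
  qed
  also have "\<dots> < real n / 2"
    using ST(4) by simp
  finally show ?lhs .
qed

section \<open>Edges between vertex sets\<close>

text \<open>Ordered pairs keep the count additive in both arguments; an edge inside \<open>A\<close>
  contributes 2 to \<open>arcs F A A\<close>.\<close>

definition arcs :: "nat set set \<Rightarrow> nat set \<Rightarrow> nat set \<Rightarrow> nat" where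
  "arcs F A B = (\<Sum>u\<in>A. \<Sum>v\<in>B. of_bool ({u, v} \<in> F))"

lemma arcs_commute: "arcs F A B = arcs F B A"
  unfolding arcs_def by (subst sum.swap) (simp add: insert_commute)

lemma arcs_Un_left:
  "finite A \<Longrightarrow> finite A' \<Longrightarrow> A \<inter> A' = {} \<Longrightarrow> arcs F (A \<union> A') B = arcs F A B + arcs F A' B"
  by (simp add: arcs_def sum.union_disjoint)

lemma arcs_Un_right:
  "finite B \<Longrightarrow> finite B' \<Longrightarrow> B \<inter> B' = {} \<Longrightarrow> arcs F A (B \<union> B') = arcs F A B + arcs F A B'"
  by (simp add: arcs_def sum.union_disjoint sum.distrib del: sum_of_bool_eq)

lemma arcs_mono:
  assumes "F \<subseteq> F'" "A \<subseteq> A'" "B \<subseteq> B'" "finite A'" "finite B'"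
  shows "arcs F A B \<le> arcs F' A' B'"
proof -
  have "arcs F A B \<le> (\<Sum>u\<in>A. \<Sum>v\<in>B'. of_bool ({u, v} \<in> F'))"
    unfolding arcs_def
    by (intro sum_mono order_trans[OF sum_mono sum_mono2]) (use assms in auto)
  also have "\<dots> \<le> arcs F' A' B'"
    unfolding arcs_def by (intro sum_mono2) (use assms in auto)
  finally show ?thesis .
qed

lemma arcs_le_card_mult: "arcs F A B \<le> card A * card B"
proof -
  have "arcs F A B \<le> (\<Sum>u\<in>A. \<Sum>v\<in>B. 1)"
    unfolding arcs_def by (intro sum_mono) auto
  then show ?thesis by simp
qed

lemma arcs_eq_0_iff:
  "finite A \<Longrightarrow> finite B \<Longrightarrow> arcs F A B = 0 \<longleftrightarrow> (\<forall>u\<in>A. \<forall>v\<in>B. {u, v} \<notin> F)"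
  by (auto simp: arcs_def)

lemma degree_eq_card:
  assumes "simple_graph n F"
  shows "degree F v = card {u\<in>{..<n}. {v, u} \<in> F}"
proof -
  have "{e\<in>F. v \<in> e} = (\<lambda>u. {v, u}) ` {u\<in>{..<n}. {v, u} \<in> F}"
  proof (intro equalityI subsetI)
    fix e assume e: "e \<in> {e\<in>F. v \<in> e}"
    then obtain a b where "e = {a, b}" "a < n" "b < n"
      using assms by (auto simp: simple_graph_def)
    with e show "e \<in> (\<lambda>u. {v, u}) ` {u\<in>{..<n}. {v, u} \<in> F}"
      by (auto simp: insert_commute)
  qed auto
  moreover have "inj_on (\<lambda>u. {v, u}) A" for A :: "nat set"
    by (auto simp: inj_on_def doubleton_eq_iff)
  ultimately show ?thesis
    by (simp add: degree_def card_image)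
qed

lemma degree_eq_sum:
  "simple_graph n F \<Longrightarrow> degree F v = (\<Sum>u<n. of_bool ({v, u} \<in> F))"
  by (simp add: degree_eq_card Int_def)

lemma handshake:
  assumes "simple_graph n F"
  shows "arcs F {..<n} {..<n} = 2 * card F"
proof -
  have fin: "finite F"
    using assms by (rule simple_graph_finite)
  have "arcs F {..<n} {..<n} = (\<Sum>v<n. degree F v)"
    by (simp add: arcs_def degree_eq_sum[OF assms])
  also have "\<dots> = (\<Sum>v<n. \<Sum>e\<in>F. of_bool (v \<in> e))"
    using fin by (simp add: degree_def Int_def)
  also have "\<dots> = (\<Sum>e\<in>F. \<Sum>v<n. of_bool (v \<in> e))"
    by (rule sum.swap)
  also have "\<dots> = (\<Sum>e\<in>F. 2)"
  proof (rule sum.cong)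
    fix e assume "e \<in> F"
    then obtain a b where "e = {a, b}" "a \<noteq> b" "a < n" "b < n"
      using assms by (auto simp: simple_graph_def)
    moreover from this have "{..<n} \<inter> {v. v \<in> e} = {a, b}"
      by auto
    moreover have "(\<Sum>v<n. of_bool (v \<in> e)) = card ({..<n} \<inter> {v. v \<in> e})"
      by simp
    ultimately show "(\<Sum>v<n. of_bool (v \<in> e)) = (2 :: nat)"
      by simp
  qed simp
  finally show ?thesis by simp
qed

text \<open>This is the handshake identity for the subgraph induced on \<open>A\<close>.\<close>

lemma even_arcs_self:
  assumes "simple_graph n F" "A \<subseteq> {..<n}"
  shows "even (arcs F A A)"
proof -
  define D where "D = {e\<in>F. e \<subseteq> A}"
  have D: "simple_graph n D"
    using assms(1) by (rule simple_graph_subset) (auto simp: D_def)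
  have "arcs F A A = arcs D A A"
    unfolding arcs_def by (intro sum.cong) (auto simp: D_def)
  also have "\<dots> = arcs D {..<n} {..<n}"
  proof -
    have "arcs D A A = (\<Sum>u\<in>A. \<Sum>v<n. of_bool ({u, v} \<in> D))"
      unfolding arcs_def
      by (intro sum.cong sum.mono_neutral_left) (use assms(2) in \<open>auto simp: D_def\<close>)
    also have "\<dots> = arcs D {..<n} {..<n}"
      unfolding arcs_def
      by (intro sum.mono_neutral_left) (use assms(2) in \<open>auto simp: D_def\<close>)
    finally show ?thesis .
  qed
  finally show ?thesis
    using handshake[OF D] by simp
qed

section \<open>Separating pairs in regular graphs\<close>

definition regular :: "nat \<Rightarrow> nat \<Rightarrow> nat set set \<Rightarrow> bool" where
  "regular n k E \<longleftrightarrow> simple_graph n E \<and> (\<forall>v<n. degree E v = k)"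

lemma regular_simple: "regular n k E \<Longrightarrow> simple_graph n E"
  by (simp add: regular_def)

lemma regular_arcs:
  assumes "regular n k E" "A \<subseteq> {..<n}"
  shows "arcs E A {..<n} = k * card A"
proof -
  have "arcs E A {..<n} = (\<Sum>u\<in>A. k)"
    unfolding arcs_def
    using assms degree_eq_sum[OF regular_simple[OF assms(1)]]
    by (intro sum.cong) (auto simp: regular_def)
  then show ?thesis by simp
qed

lemma regular_arcs_split:
  assumes "regular n k E" "A \<subseteq> {..<n}" "B \<subseteq> {..<n}"
  shows "arcs E A B + arcs E A ({..<n} - B) = k * card A"
proof -
  have "{..<n} = B \<union> ({..<n} - B)"
    using assms(3) by auto
  then have "arcs E A {..<n} = arcs E A B + arcs E A ({..<n} - B)"
    using arcs_Un_right[of B "{..<n} - B" E A] assms(3) finite_subset by fastforce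
  with regular_arcs[OF assms(1,2)] show ?thesis by simp
qed

lemma regular_cut_parity:
  assumes "regular n k E" "A \<subseteq> {..<n}"
  shows "even (arcs E A ({..<n} - A)) \<longleftrightarrow> even (k * card A)"
  using regular_arcs_split[OF assms(1,2,2)] even_arcs_self[OF regular_simple[OF assms(1)] assms(2)]
  by (metis even_add)

text \<open>The edges whose deletion turns \<open>S\<close> into an independent set with all neighbours in \<open>T\<close>.\<close>

definition isolating_edges :: "nat set set \<Rightarrow> nat set \<Rightarrow> nat set \<Rightarrow> nat set set" where
  "isolating_edges E S T = {e\<in>E. e \<inter> S \<noteq> {} \<and> e \<inter> T = {}}"

text \<open>Excess exactly 1 suffices, since a larger \<open>S\<close> can be shrunk, and it makes
  the deletion cost computable from \<open>k\<close>.\<close>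

definition sep_pair :: "nat \<Rightarrow> nat set \<Rightarrow> nat set \<Rightarrow> bool" where
  "sep_pair n S T \<longleftrightarrow>
     S \<subseteq> {..<n} \<and> T \<subseteq> {..<n} \<and> S \<inter> T = {} \<and> card S = Suc (card T)"

lemma mu_le_isolating_edges:
  assumes "simple_graph n E" "sep_pair n S T"
  shows "mu n E \<le> card (isolating_edges E S T)"
proof -
  let ?D = "isolating_edges E S T"
  have "tau_star n (E - ?D) < real n / 2"
    unfolding tau_star_less_half_iff[OF simple_graph_subset[OF assms(1) Diff_subset]]
    using assms(2) by (intro exI[of _ S] exI[of _ T])
      (auto simp: sep_pair_def isolating_edges_def)
  moreover have "?D \<subseteq> E"
    by (auto simp: isolating_edges_def)
  ultimately show ?thesis
    unfolding mu_def by (intro Least_le) blast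
qed

text \<open>Deleting the \<open>k\<close> edges at vertex 0 isolates it.\<close>

lemma mu_le_regular:
  assumes "regular n k E" "n > 0"
  shows "mu n E \<le> k"
proof -
  have "sep_pair n {0} {}"
    using assms(2) by (simp add: sep_pair_def)
  moreover have "isolating_edges E {0} {} = {e\<in>E. 0 \<in> e}"
    by (auto simp: isolating_edges_def)
  ultimately show ?thesis
    using mu_le_isolating_edges[OF regular_simple[OF assms(1)]] assms
    by (metis degree_def regular_def)
qed

text \<open>A minimum deletion set yields \<open>S\<close> and \<open>T\<close>. Shrinking
  \<open>S\<close> to size \<open>card T + 1\<close> keeps its neighbours in \<open>T\<close>, so
  every isolating edge of the new pair was deleted.\<close>

lemma le_mu:
  assumes E: "simple_graph n E" and "n > 0"
    and le: "\<And>S T. sep_pair n S T \<Longrightarrow> m \<le> card (isolating_edges E S T)"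
  shows "m \<le> mu n E"
proof -
  let ?P = "\<lambda>m. \<exists>E'. E' \<subseteq> E \<and> card E' = m \<and> tau_star n (E - E') < real n / 2"
  \<comment> \<open>\<open>LeastI\<close> needs one successful deletion; removing all edges works
    because \<open>n > 0\<close>.\<close>
  have "tau_star n (E - E) < real n / 2"
    unfolding tau_star_less_half_iff[OF simple_graph_subset[OF E Diff_subset]]
    using \<open>n > 0\<close> by (intro exI[of _ "{0}"] exI[of _ "{}"]) auto
  then have "?P (card E)" by blast
  then have "?P (mu n E)"
    unfolding mu_def by (rule LeastI)
  then obtain E' where E': "E' \<subseteq> E" "card E' = mu n E" "tau_star n (E - E') < real n / 2"
    by blast
  from E'(3) obtain S T where ST: "S \<subseteq> {..<n}" "T \<subseteq> {..<n}" "S \<inter> T = {}" "card T < card S"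
    "\<And>u v. u \<in> S \<Longrightarrow> {u, v} \<in> E - E' \<Longrightarrow> v \<in> T"
    unfolding tau_star_less_half_iff[OF simple_graph_subset[OF E Diff_subset]] by blast
  obtain S' where S': "S' \<subseteq> S" "card S' = Suc (card T)"
    using obtain_subset_with_card_n[of "Suc (card T)" S] ST(4) by auto
  have "isolating_edges E S' T \<subseteq> E'"
  proof
    fix e assume e: "e \<in> isolating_edges E S' T"
    then have "e \<in> E"
      by (simp add: isolating_edges_def)
    then obtain a b where ab: "e = {a, b}"
      using E unfolding simple_graph_def by blast
    with e have "a \<in> S' \<or> b \<in> S'"
      by (auto simp: isolating_edges_def)
    with ab obtain u v where "e = {u, v}" "u \<in> S'"
      by (metis insert_commute)
    with e ST(5)[of u v] S'(1) show "e \<in> E'"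
      by (auto simp: isolating_edges_def)
  qed
  moreover have "finite E'"
    using simple_graph_finite[OF E] E'(1) by (rule rev_finite_subset)
  ultimately have "card (isolating_edges E S' T) \<le> mu n E"
    using E'(2) by (metis card_mono)
  moreover have "sep_pair n S' T"
    using ST S' by (auto simp: sep_pair_def)
  ultimately show ?thesis
    using le[of S' T] by linarith
qed

text \<open>Double count: \<open>2 * card ?D\<close> is \<open>arcs E S S + 2 * arcs E S R\<close>.
  The degree sums over \<open>S\<close> and \<open>T\<close> differ by \<open>k\<close>, and
  subtracting them eliminates the edges between \<open>S\<close> and \<open>T\<close>.\<close>

lemma card_isolating_edges:
  assumes reg: "regular n k E" and sep: "sep_pair n S T"
    and R: "R = {..<n} - (S \<union> T)"
  shows "2 * card (isolating_edges E S T) = k + arcs E T T + arcs E R ({..<n} - R)"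
proof -
  let ?D = "isolating_edges E S T"
  note ST = sep[unfolded sep_pair_def]
  have fin: "finite S" "finite T" "finite R"
    using ST R finite_subset by blast+
  have V: "{..<n} = S \<union> (T \<union> R)" and disj: "S \<inter> (T \<union> R) = {}" "T \<inter> R = {}"
    using ST R by auto
  have split: "arcs F A {..<n} = arcs F A S + arcs F A T + arcs F A R" for F A
    unfolding V using fin disj by (simp add: arcs_Un_right)
  have split': "arcs F {..<n} A = arcs F S A + arcs F T A + arcs F R A" for F A
    using split arcs_commute by metis
  have D: "simple_graph n ?D"
    using regular_simple[OF reg] by (rule simple_graph_subset) (auto simp: isolating_edges_def)
  have D0: "arcs ?D T A = 0" "arcs ?D A T = 0" "arcs ?D R R = 0" for A
    using ST R by (auto simp: arcs_def isolating_edges_def)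
  have DE: "arcs ?D S S = arcs E S S" "arcs ?D S R = arcs E S R"
    unfolding arcs_def using ST R
    by (auto simp: isolating_edges_def simp del: sum_of_bool_eq intro!: sum.cong arg_cong[where f = of_bool])
  have "2 * card ?D = arcs E S S + 2 * arcs E S R"
    using handshake[OF D] arcs_commute[of ?D R S] by (simp add: split split' D0 DE)
  moreover have "arcs E S S + arcs E S T + arcs E S R = k * card T + k"
    using regular_arcs[OF reg, of S] ST split[of E S] by simp
  moreover have "arcs E T S + arcs E T T + arcs E T R = k * card T"
    using regular_arcs[OF reg, of T] ST split[of E T] by simp
  moreover have "arcs E R ({..<n} - R) = arcs E S R + arcs E T R"
  proof -
    have "{..<n} - R = S \<union> T"
      using ST R by auto
    then show ?thesis
      using fin ST by (simp add: arcs_commute[of E R] arcs_Un_left)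
  qed
  ultimately show ?thesis
    using arcs_commute[of E S T] by linarith
qed

section \<open>Circulant graphs\<close>

lemma add_mod_eq_if:
  fixes n :: nat
  assumes "x < n" "j < n"
  shows "(x + j) mod n = (if x + j < n then x + j else x + j - n)"
  using assms by (simp add: mod_if)

lemma inj_on_add_mod:
  fixes n :: nat
  assumes "x < n"
  shows "inj_on (\<lambda>j. (x + j) mod n) {..<n}"
  by (rule inj_onI) (use assms in \<open>auto simp: add_mod_eq_if split: if_splits\<close>)

definition circulant :: "nat \<Rightarrow> nat set \<Rightarrow> nat set set" where
  "circulant n J = {{x, (x + j) mod n} | x j. x < n \<and> j \<in> J}"

lemma circulant_mono: "J \<subseteq> J' \<Longrightarrow> circulant n J \<subseteq> circulant n J'"
  by (auto simp: circulant_def)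

lemma circulant_simple:
  assumes "J \<subseteq> {1..<n}"
  shows "simple_graph n (circulant n J)"
  unfolding simple_graph_def
proof
  fix e assume "e \<in> circulant n J"
  then obtain x j where x: "e = {x, (x + j) mod n}" "x < n" "j \<in> J"
    by (auto simp: circulant_def)
  moreover have "1 \<le> j" "j < n"
    using x(3) assms by auto
  ultimately have "(x + j) mod n \<noteq> x" "(x + j) mod n < n"
    by (auto simp: add_mod_eq_if split: if_splits)
  with x show "\<exists>u v. e = {u, v} \<and> u \<noteq> v \<and> u < n \<and> v < n"
    by metis
qed

text \<open>A backward jump by \<open>j\<close> is a forward jump by \<open>n - j\<close>, so
  symmetry of \<open>J\<close> lets an edge be read from either end.\<close>

lemma circulant_edge_iff:
  assumes "J \<subseteq> {1..<n}" "\<And>j. j \<in> J \<Longrightarrow> n - j \<in> J" "u < n"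
  shows "{u, v} \<in> circulant n J \<longleftrightarrow> (\<exists>j\<in>J. v = (u + j) mod n)"
proof
  assume "{u, v} \<in> circulant n J"
  then obtain x j where x: "{u, v} = {x, (x + j) mod n}" "x < n" "j \<in> J"
    by (auto simp: circulant_def)
  then have j: "1 \<le> j" "j < n"
    using assms(1) by auto
  from x(1) consider "u = x" "v = (x + j) mod n" | "v = x" "u = (x + j) mod n"
    by (auto simp: doubleton_eq_iff)
  then show "\<exists>j\<in>J. v = (u + j) mod n"
  proof cases
    case 1
    with x(3) show ?thesis by blast
  next
    case 2
    then have "v = (u + (n - j)) mod n"
      using x(2) j assms(3) by (simp add: add_mod_eq_if split: if_splits)
    with assms(2)[OF x(3)] show ?thesis by blast
  qed
qed (use assms(3) in \<open>auto simp: circulant_def\<close>)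

lemma circulant_regular:
  assumes "J \<subseteq> {1..<n}" "\<And>j. j \<in> J \<Longrightarrow> n - j \<in> J"
  shows "regular n (card J) (circulant n J)"
  unfolding regular_def
proof (intro conjI allI impI)
  show simple: "simple_graph n (circulant n J)"
    using assms(1) by (rule circulant_simple)
  fix u assume "u < n"
  have "degree (circulant n J) u = card {v\<in>{..<n}. {u, v} \<in> circulant n J}"
    using degree_eq_sum[OF simple] by (simp add: Int_def)
  also have "{v\<in>{..<n}. {u, v} \<in> circulant n J} = (\<lambda>j. (u + j) mod n) ` J"
    using circulant_edge_iff[OF assms \<open>u < n\<close>] \<open>u < n\<close> by auto
  also have "card \<dots> = card J"
    using assms(1) by (intro card_image inj_on_subset[OF inj_on_add_mod[OF \<open>u < n\<close>]]) auto
  finally show "degree (circulant n J) u = card J" .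
qed

text \<open>Jumps are listed together with their negatives modulo \<open>n\<close>. The jump
  \<open>n / 2\<close> is its own negative and adds only 1 to the degree, as odd \<open>k\<close>
  requires.\<close>

definition jumps :: "nat \<Rightarrow> nat \<Rightarrow> nat set" where
  "jumps n k =
     {j\<in>{1..<n}. j \<le> k div 2 \<or> n - j \<le> k div 2 \<or> (odd k \<and> 2 * j = n)}"

lemma card_jumps:
  assumes "k < n" "even (k * n)"
  shows "card (jumps n k) = k"
proof -
  define r where "r = k div 2"
  have r: "2 * r < n"
    using assms(1) by (simp add: r_def)
  have A: "card ({1..r} \<union> {n - r..<n}) = 2 * r"
    using r by (subst card_Un_disjoint) auto
  show ?thesis
  proof (cases "even k")
    case True
    then have "jumps n k = {1..r} \<union> {n - r..<n}"
      using r by (auto simp: jumps_def r_def)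
    with A True show ?thesis
      by (simp add: r_def)
  next
    case False
    with assms(2) obtain h where h: "n = 2 * h" by auto
    have "r < h"
      using r h by simp
    have "jumps n k = insert h ({1..r} \<union> {n - r..<n})"
      using r False h \<open>r < h\<close> by (auto simp: jumps_def r_def)
    moreover have "h \<notin> {1..r} \<union> {n - r..<n}"
      using h \<open>r < h\<close> by auto
    ultimately have "card (jumps n k) = Suc (2 * r)"
      using A by simp
    with False show ?thesis
      by (simp add: r_def)
  qed
qed

text \<open>For \<open>2 \<le> k < n\<close> and \<open>k * n\<close> even this is the Harary
  graph.\<close>

definition extremal :: "nat \<Rightarrow> nat \<Rightarrow> nat set set" where
  "extremal n k = circulant n (jumps n k)"

lemma extremal_regular:
  assumes "k < n" "even (k * n)"
  shows "regular n k (extremal n k)"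
proof -
  have "n - j \<in> jumps n k" if "j \<in> jumps n k" for j
    using that by (auto simp: jumps_def)
  then show ?thesis
    using circulant_regular[of "jumps n k" n] card_jumps[OF assms]
    by (simp add: extremal_def jumps_def subset_iff)
qed

lemma extremal_edge:
  assumes "x < n" "j \<in> jumps n k"
  shows "{x, (x + j) mod n} \<in> extremal n k"
  using assms by (auto simp: extremal_def circulant_def)

section \<open>Cuts and spanned edges of the extremal graphs\<close>

text \<open>A nonempty set closed under the cyclic successor contains a full orbit, hence all
  vertices.\<close>

lemma ex_cyclic_boundary:
  assumes "R \<subseteq> {..<n}" "R \<noteq> {}" "R \<noteq> {..<n}"
  shows "\<exists>x\<in>R. Suc x mod n \<notin> R"
proof (rule ccontr)
  assume "\<not> ?thesis"
  then have step: "Suc x mod n \<in> R" if "x \<in> R" for x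
    using that by blast
  obtain z where z: "z \<in> R"
    using assms(2) by blast
  have orbit: "(z + i) mod n \<in> R" for i
  proof (induction i)
    case 0
    show ?case using z assms(1) by auto
  next
    case (Suc i)
    then show ?case using step[of "(z + i) mod n"] by (simp add: mod_Suc_eq)
  qed
  have "y \<in> R" if "y < n" for y
  proof -
    have "(z + (n - z + y)) mod n = y"
      using z assms(1) that by auto
    then show ?thesis using orbit by metis
  qed
  with assms(1,3) show False by auto
qed

text \<open>If \<open>x \<in> R\<close> and \<open>x + 1 \<notin> R\<close>, the edge between them and one edge at each of their
  \<open>2 r - 2\<close> common neighbours lie in the cut; parity supplies the missing one.\<close>

lemma extremal_even_cut:
  assumes "2 * r < n" "R \<subseteq> {..<n}" "R \<noteq> {}" "R \<noteq> {..<n}"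
  shows "2 * r \<le> arcs (extremal n (2 * r)) R ({..<n} - R)"
proof (cases "r = 0")
  case False
  let ?E = "extremal n (2 * r)"
  have reg: "regular n (2 * r) ?E"
    using assms(1) by (intro extremal_regular) auto
  obtain x where x: "x \<in> R" "Suc x mod n \<notin> R"
    using ex_cyclic_boundary[OF assms(2-4)] by blast
  define y where "y = Suc x mod n"
  have xy: "x < n" "y < n" "y \<notin> R" "x \<noteq> y"
    using x assms(1,2) by (auto simp: y_def)
  \<comment> \<open>These are the \<open>j\<close> for which both \<open>j\<close> and
    \<open>j - 1\<close> are jumps, so that \<open>x + j\<close> is a common neighbour of
    \<open>x\<close> and \<open>y = x + 1\<close>.\<close>
  define I where "I = {2..r} \<union> {n - r + 1..<n}"
  define W where "W = (\<lambda>j. (x + j) mod n) ` I"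
  have I: "I \<subseteq> {2..<n}"
    using assms(1) by (auto simp: I_def)
  have "card I = 2 * r - 2"
    unfolding I_def using assms(1) by (subst card_Un_disjoint) auto
  moreover have inj: "inj_on (\<lambda>j. (x + j) mod n) I"
    using I by (intro inj_on_subset[OF inj_on_add_mod[OF xy(1)]]) auto
  ultimately have W: "card W = 2 * r - 2"
    by (simp add: W_def card_image)
  have Wn: "W \<subseteq> {..<n}"
    using xy by (auto simp: W_def)
  have xW: "x \<notin> W" "y \<notin> W"
    using I xy(1) by (auto simp: W_def y_def add_mod_eq_if mod_Suc split: if_splits)
  have edge: "{x, w} \<in> ?E" "{w, y} \<in> ?E" if "w \<in> W" for w
  proof -
    obtain j where j: "j \<in> I" "w = (x + j) mod n"
      using \<open>w \<in> W\<close> by (auto simp: W_def)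
    have J: "j \<in> jumps n (2 * r)" "j - 1 \<in> jumps n (2 * r)"
      using j(1) assms(1) by (auto simp: I_def jumps_def)
    show "{x, w} \<in> ?E"
      using extremal_edge[OF xy(1) J(1)] j(2) by simp
    have "(y + (j - 1)) mod n = (Suc x + (j - 1)) mod n"
      by (simp add: y_def mod_add_left_eq)
    also have "\<dots> = w"
      using j I by auto
    finally show "{w, y} \<in> ?E"
      using extremal_edge[OF xy(2) J(2)] by (simp add: insert_commute)
  qed
  have "{x, y} \<in> ?E"
    using extremal_edge[of x n 1 "2 * r"] xy(1) False assms(1) by (simp add: jumps_def y_def)
  have finR: "finite R"
    using assms(2) finite_subset by blast
  \<comment> \<open>A common neighbour outside \<open>R\<close> gives a cut edge at
    \<open>x\<close>, one inside \<open>R\<close> a cut edge at \<open>y\<close>. Counting the row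
    of \<open>x\<close> separately avoids overlap.\<close>
  have "1 + card (W - R) = (\<Sum>v\<in>insert y (W - R). 1)"
    using xW finite_subset[OF Wn] by simp
  also have "\<dots> \<le> arcs ?E {x} ({..<n} - R)"
  proof -
    have "(\<Sum>v\<in>insert y (W - R). 1 :: nat) = (\<Sum>v\<in>insert y (W - R). of_bool ({x, v} \<in> ?E))"
      using edge(1) \<open>{x, y} \<in> ?E\<close> by (intro sum.cong) auto
    also have "\<dots> \<le> (\<Sum>v\<in>{..<n} - R. of_bool ({x, v} \<in> ?E))"
      using xy Wn by (intro sum_mono2) auto
    finally show ?thesis by (simp add: arcs_def)
  qed
  finally have 1: "1 + card (W - R) \<le> arcs ?E {x} ({..<n} - R)" .
  have "card (W \<inter> R) = (\<Sum>u\<in>W \<inter> R. of_bool ({u, y} \<in> ?E))"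
    using edge(2) by (simp add: Int_def)
  also have "\<dots> \<le> (\<Sum>u\<in>R - {x}. of_bool ({u, y} \<in> ?E))"
    using xW finR by (intro sum_mono2) auto
  also have "\<dots> = arcs ?E (R - {x}) {y}"
    by (simp add: arcs_def del: sum_of_bool_eq)
  also have "\<dots> \<le> arcs ?E (R - {x}) ({..<n} - R)"
    using xy finR by (intro arcs_mono) auto
  finally have 2: "card (W \<inter> R) \<le> arcs ?E (R - {x}) ({..<n} - R)" .
  have "arcs ?E R ({..<n} - R) = arcs ?E {x} ({..<n} - R) + arcs ?E (R - {x}) ({..<n} - R)"
    using arcs_Un_left[of "{x}" "R - {x}"] x(1) finR by (simp add: insert_absorb)
  moreover have "card W = card (W - R) + card (W \<inter> R)"
    using finite_subset[OF Wn] card_Int_Diff[of W R] by simp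
  ultimately have "2 * r - 1 \<le> arcs ?E R ({..<n} - R)"
    using 1 2 W by linarith
  moreover have "even (arcs ?E R ({..<n} - R))"
    using regular_cut_parity[OF reg assms(2)] by simp
  ultimately show ?thesis
    using False by (auto elim!: evenE)
qed simp

text \<open>The subgraph with jumps up to \<open>k div 2\<close> already gives
  \<open>2 * (k div 2)\<close>; for odd \<open>k\<close> the cut is odd, which gains the last
  edge.\<close>

lemma extremal_cut:
  assumes "k < n" "even (k * n)" "R \<subseteq> {..<n}" "R \<noteq> {}" "R \<noteq> {..<n}" "odd k \<Longrightarrow> odd (card R)"
  shows "k \<le> arcs (extremal n k) R ({..<n} - R)"
proof -
  define r where "r = k div 2"
  have "jumps n (2 * r) \<subseteq> jumps n k"
    by (auto simp: jumps_def r_def)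
  then have "arcs (extremal n (2 * r)) R ({..<n} - R) \<le> arcs (extremal n k) R ({..<n} - R)"
    unfolding extremal_def using assms(3)
    by (intro arcs_mono circulant_mono) (auto intro: finite_subset)
  moreover have "2 * r \<le> arcs (extremal n (2 * r)) R ({..<n} - R)"
    using assms by (intro extremal_even_cut) (auto simp: r_def)
  ultimately have le: "2 * r \<le> arcs (extremal n k) R ({..<n} - R)"
    by simp
  show ?thesis
  proof (cases "even k")
    case True
    with le show ?thesis by (simp add: r_def)
  next
    case False
    then have "odd (arcs (extremal n k) R ({..<n} - R))"
      using regular_cut_parity[OF extremal_regular[OF assms(1,2)] assms(3)] assms(6) by simp
    moreover have "k = 2 * r + 1"
      using False by (simp add: r_def)
    ultimately show ?thesis
      using le by (auto elim!: oddE)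
  qed
qed

text \<open>Let \<open>B\<close> be the vertices of \<open>T\<close> with no vertex of \<open>T\<close> among their \<open>r\<close> successors. The
  blocks of \<open>r\<close> successors of distinct vertices of \<open>B\<close> are disjoint and avoid \<open>T\<close>, which bounds
  \<open>card B\<close>; here \<open>a = card (T - B)\<close>.\<close>

lemma extremal_span:
  assumes "2 * (k div 2) < n" "T \<subseteq> {..<n}"
  obtains a where "2 * a \<le> arcs (extremal n k) T T"
    "(k div 2) * (card T - a) \<le> n - card T"
proof -
  define r where "r = k div 2"
  have r: "2 * r < n"
    using assms(1) by (simp add: r_def)
  define fw where "fw u v \<longleftrightarrow> (\<exists>j\<in>{1..r}. v = (u + j) mod n)" for u v
  define B where "B = {x\<in>T. \<forall>j\<in>{1..r}. (x + j) mod n \<notin> T}"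
  have finT: "finite T"
    using assms(2) finite_subset by blast
  have Tn: "x < n" if "x \<in> T" for x
    using that assms(2) by auto
  have BT: "B \<subseteq> T"
    by (auto simp: B_def)
  have "card (B \<times> {1..r}) \<le> card ({..<n} - T)"
  proof (rule card_inj_on_le)
    show "(\<lambda>(x, j). (x + j) mod n) ` (B \<times> {1..r}) \<subseteq> {..<n} - T"
      using r by (auto simp: B_def)
    \<comment> \<open>If two blocks met with \<open>i' < i\<close>, then \<open>x'\<close> would be
      the successor of \<open>x\<close> at distance \<open>i - i'\<close> and would lie in
      \<open>T\<close>, contradicting \<open>x \<in> B\<close>.\<close>
    have lt: "i' \<ge> i" if xs: "x \<in> B" "x' \<in> B" "i \<in> {1..r}" "i' \<in> {1..r}"
      "(x + i) mod n = (x' + i') mod n" for x x' i i'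
    proof (rule ccontr)
      assume "\<not> i' \<ge> i"
      then obtain d where d: "i = i' + d" "d \<in> {1..r}"
        using xs(3) by (auto dest!: less_imp_Suc_add simp: not_le)
      moreover have "x < n" "x' < n"
        using xs BT Tn by auto
      ultimately have "x' = (x + d) mod n"
        using xs(3-5) r by (auto simp: add_mod_eq_if split: if_splits)
      moreover have "x' \<in> T"
        using xs BT by auto
      ultimately show False
        using xs(1) d(2) by (auto simp: B_def)
    qed
    show "inj_on (\<lambda>(x, j). (x + j) mod n) (B \<times> {1..r})"
    proof (rule inj_onI, clarify)
      fix x i x' i' assume xs: "x \<in> B" "x' \<in> B" "i \<in> {1..r}" "i' \<in> {1..r}"
        "(x + i) mod n = (x' + i') mod n"
      have "i = i'"
        using lt[OF xs] lt[OF xs(2,1,4,3) xs(5)[symmetric]] by simp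
      moreover have "x < n" "x' < n"
        using xs BT Tn by auto
      ultimately show "x = x' \<and> i = i'"
        using xs(3-5) r by (auto simp: add_mod_eq_if split: if_splits)
    qed
  qed simp
  then have "r * card B \<le> n - card T"
    using assms(2) finT by (simp add: card_Diff_subset card_cartesian_product mult.commute)
  moreover have "card B = card T - card (T - B)"
    using BT finT card_mono[OF finT BT] by (simp add: card_Diff_subset finite_subset)
  moreover have "2 * card (T - B) \<le> arcs (extremal n k) T T"
  proof -
    have row: "1 \<le> (\<Sum>v\<in>T. of_bool (fw u v) :: nat)" if "u \<in> T - B" for u
    proof -
      obtain j where "j \<in> {1..r}" "(u + j) mod n \<in> T"
        using \<open>u \<in> T - B\<close> by (auto simp: B_def)
      then have "(of_bool (fw u ((u + j) mod n)) :: nat) \<le> (\<Sum>v\<in>T. of_bool (fw u v))"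
        using finT by (intro member_le_sum) auto
      moreover have "fw u ((u + j) mod n)"
        using \<open>j \<in> {1..r}\<close> by (auto simp: fw_def)
      ultimately show ?thesis by simp
    qed
    have "card (T - B) = (\<Sum>u\<in>T - B. 1)"
      by simp
    also have "\<dots> \<le> (\<Sum>u\<in>T - B. \<Sum>v\<in>T. of_bool (fw u v))"
      by (intro sum_mono row)
    also have "\<dots> \<le> (\<Sum>u\<in>T. \<Sum>v\<in>T. of_bool (fw u v))"
      using finT by (intro sum_mono2) auto
    finally have "2 * card (T - B) \<le> 2 * (\<Sum>u\<in>T. \<Sum>v\<in>T. of_bool (fw u v))"
      by (rule mult_le_mono2)
    also have "\<dots> = (\<Sum>u\<in>T. \<Sum>v\<in>T. of_bool (fw u v) + of_bool (fw v u))"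
      using sum.swap[of "\<lambda>u v. of_bool (fw u v) :: nat" T T]
      by (simp add: sum.distrib del: sum_of_bool_eq)
    also have "\<dots> \<le> arcs (extremal n k) T T"
      unfolding arcs_def
    proof (intro sum_mono)
      fix u v assume uv: "u \<in> T" "v \<in> T"
      have "j \<in> jumps n k" if "j \<in> {1..r}" for j
        using that r by (auto simp: jumps_def r_def)
      then have E: "{u, v} \<in> extremal n k" if "u \<in> T" "fw u v" for u v
        using that Tn extremal_edge by (auto simp: fw_def)
      \<comment> \<open>Two opposite forward jumps would sum to a multiple of \<open>n\<close>, but
        their sum lies between 2 and \<open>2 * r < n\<close>. So each edge is counted in one
        direction only.\<close>
      have "\<not> (fw u v \<and> fw v u)"
        using Tn[OF uv(1)] Tn[OF uv(2)] r
        by (auto simp: fw_def add_mod_eq_if split: if_splits)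
      with E[OF uv(1), of v] E[OF uv(2), of u]
      show "of_bool (fw u v) + of_bool (fw v u) \<le> (of_bool ({u, v} \<in> extremal n k) :: nat)"
        by (auto simp: insert_commute)
    qed
    finally show ?thesis .
  qed
  ultimately show thesis
    using that[of "card (T - B)"] by (simp add: r_def)
qed

section \<open>The extremal graphs\<close>

text \<open>This is the case of empty \<open>R\<close>. For \<open>r = m\<close> the graph is
  complete, and counting edges from \<open>T\<close> to its complement suffices; for
  \<open>r < m\<close> the block bound of \<open>extremal_span\<close> does, up to small
  cases.\<close>

lemma extremal_isolating_edges_span:
  assumes n: "n = 2 * m + 1" "r \<le> m" and T: "T \<subseteq> {..<n}" "card T = m"
  shows "2 * r \<le> arcs (extremal n (2 * r)) T T \<or>
    r = 1 \<or> r = 2 \<and> m \<in> {2, 3} \<and> 2 \<le> arcs (extremal n (2 * r)) T T"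
proof -
  let ?E = "extremal n (2 * r)"
  obtain a where a: "2 * a \<le> arcs ?E T T" "r * (m - a) \<le> m + 1"
    using extremal_span[of "2 * r" n T] n T by auto
  have reg: "regular n (2 * r) ?E"
    using n by (intro extremal_regular) auto
  have "arcs ?E T ({..<n} - T) \<le> m * (m + 1)"
    using arcs_le_card_mult[of ?E T "{..<n} - T"] T n finite_subset[OF T(1)]
    by (simp add: card_Diff_subset)
  then have sat: "2 * r * m \<le> arcs ?E T T + m * (m + 1)"
    using regular_arcs_split[OF reg T(1,1)] unfolding T(2) by linarith
  consider "r = 0" | "r = 1" | "2 \<le> r" "r = m" | "2 \<le> r" "r < m"
    using n(2) by linarith
  then show ?thesis
  proof cases
    case 3
    show ?thesis
    proof (cases "m = 2")
      case True
      with 3 sat show ?thesis by simp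
    next
      case False
      with 3 have "3 * m \<le> m * m" by simp
      then have "2 * r \<le> arcs ?E T T"
        using sat unfolding \<open>r = m\<close> add_mult_distrib2 mult_1_right mult.assoc by linarith
      then show ?thesis ..
    qed
  next
    case 4
    show ?thesis
    proof (cases "r \<le> a")
      case True
      with a(1) show ?thesis by linarith
    next
      case False
      \<comment> \<open>With \<open>a < r\<close> the bound becomes
        \<open>(p + 2) * (q + 2) \<le> p + q + 4\<close>, forcing \<open>p = q = 0\<close>, that is
        \<open>r = 2\<close> and \<open>m = 3\<close>; there \<open>a = 0\<close> would give
        \<open>6 \<le> 4\<close>.\<close>
      define p q where "p = r - 2" and "q = m - r - 1"
      then have pq: "r = p + 2" "m = r + 1 + q"
        using 4 by auto
      have "q + 2 \<le> m - a"
        using False pq by simp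
      then have "r * (q + 2) \<le> m + 1"
        using a(2) mult_le_mono2[of "q + 2" "m - a" r] by linarith
      then have "p = 0" "q = 0"
        using pq by (auto simp: algebra_simps)
      with pq a show ?thesis
        by (cases a) auto
    qed
  qed auto
qed

definition exceptional :: "nat \<Rightarrow> nat \<Rightarrow> bool" where
  "exceptional n k \<longleftrightarrow> (k = 2 \<and> odd n) \<or> (k = 4 \<and> n \<in> {5, 7})"

text \<open>By \<open>card_isolating_edges\<close> a cost of \<open>k\<close> needs a further
  contribution \<open>k\<close>: the cut around \<open>R\<close> supplies it if \<open>R\<close> is
  nonempty, otherwise the edges inside \<open>T\<close> do, except in the small cases.\<close>

lemma mu_extremal_ge:
  assumes "k < n" "even (k * n)"
  shows "(if exceptional n k then k - 1 else k) \<le> mu n (extremal n k)"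
proof (rule le_mu)
  let ?E = "extremal n k"
  have reg: "regular n k ?E"
    using assms by (rule extremal_regular)
  show "simple_graph n ?E"
    using reg by (rule regular_simple)
  show "n > 0"
    using assms by simp
  fix S T assume sep: "sep_pair n S T"
  define R where "R = {..<n} - (S \<union> T)"
  note ST = sep[unfolded sep_pair_def]
  have fin: "finite S" "finite T"
    using ST finite_subset by blast+
  have card: "n = card R + 2 * card T + 1"
  proof -
    have "card (S \<union> T) \<le> n"
      using ST card_mono[of "{..<n}" "S \<union> T"] by simp
    then show ?thesis
      using ST fin by (simp add: R_def card_Diff_subset card_Un_disjoint)
  qed
  note D = card_isolating_edges[OF reg sep R_def]
  show "(if exceptional n k then k - 1 else k) \<le> card (isolating_edges ?E S T)"
  proof (cases "R = {}")
    case False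
    have "R \<noteq> {..<n}"
    proof -
      obtain s where "s \<in> S"
        using ST by fastforce
      then show ?thesis
        using ST by (auto simp: R_def)
    qed
    \<comment> \<open>For odd \<open>k\<close>, \<open>n\<close> is even, and \<open>card R\<close>
      is \<open>n - 2 * card T - 1\<close>.\<close>
    moreover have "odd (card R)" if "odd k"
      using that assms(2) card by auto
    ultimately have "k \<le> arcs ?E R ({..<n} - R)"
      using assms False by (intro extremal_cut) (auto simp: R_def)
    with D have "k \<le> card (isolating_edges ?E S T)" by linarith
    then show ?thesis by auto
  next
    case True
    define m where "m = card T"
    have n: "n = 2 * m + 1"
      using card True by (simp add: m_def)
    with assms(2) have "even k" by simp
    then obtain r where k: "k = 2 * r" by blast
    have "r \<le> m"
      using n k assms(1) by simp
    then show ?thesis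
      using extremal_isolating_edges_span[OF n _ _ m_def[symmetric], of r] ST D n
      by (auto simp: exceptional_def k)
  qed
qed

section \<open>The exceptional cases\<close>

text \<open>Take \<open>card T\<close> maximal among the pairs with \<open>N(T) \<subseteq> S\<close>. An edge from \<open>S\<close> to the rest would end
  at a vertex \<open>u\<close> that could join \<open>T\<close>, its other neighbour joining \<open>S\<close>; if that neighbour is
  already in \<open>S\<close>, any further outside vertex can join instead, and one exists by parity.\<close>

lemma mu_two_regular_odd:
  assumes reg: "regular n 2 E" and "odd n"
  shows "mu n E \<le> 1"
proof -
  note simple = regular_simple[OF reg]
  define P where "P T \<longleftrightarrow> (\<exists>S. sep_pair n S T \<and> (\<forall>u\<in>T. \<forall>v. {u, v} \<in> E \<longrightarrow> v \<in> S))" for T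
  have "n > 0"
    using \<open>odd n\<close> by (rule odd_pos)
  then have "P {}"
    unfolding P_def by (intro exI[of _ "{0}"]) (simp add: sep_pair_def)
  moreover have "\<forall>T. P T \<longrightarrow> card T < Suc n"
  proof (intro allI impI)
    fix T assume "P T"
    then have "T \<subseteq> {..<n}"
      by (auto simp: P_def sep_pair_def)
    then show "card T < Suc n"
      using card_mono[of "{..<n}" T] by simp
  qed
  ultimately have "\<exists>T. P T \<and> (\<forall>T'. P T' \<longrightarrow> card T' \<le> card T)"
    by (rule ex_has_greatest_nat)
  then obtain T where "P T" and max: "\<And>T'. P T' \<Longrightarrow> card T' \<le> card T"
    by blast
  then obtain S where sep: "sep_pair n S T" and NT: "\<And>u v. u \<in> T \<Longrightarrow> {u, v} \<in> E \<Longrightarrow> v \<in> S"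
    unfolding P_def by blast
  note ST = sep[unfolded sep_pair_def]
  have fin: "finite S" "finite T"
    using ST finite_subset by blast+
  define R where "R = {..<n} - (S \<union> T)"
  have "card (S \<union> T) \<le> n"
    using ST card_mono[of "{..<n}" "S \<union> T"] by simp
  then have "card R + 2 * card T + 1 = n"
    using ST fin by (simp add: R_def card_Diff_subset card_Un_disjoint)
  with \<open>odd n\<close> have "even (card R)" by presburger
  have "{u, s} \<notin> E" if us: "u \<in> R" "s \<in> {..<n} - R" for u s
  proof
    assume e: "{u, s} \<in> E"
    have "s \<in> S"
    proof (rule ccontr)
      assume "s \<notin> S"
      with us(2) have "s \<in> T" by (auto simp: R_def)
      with NT[of s u] e us(1) show False
        by (auto simp: R_def insert_commute)
    qed
    define N where "N = {v\<in>{..<n}. {u, v} \<in> E}"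
    have "u < n"
      using us(1) by (simp add: R_def)
    then have "card N = 2"
      using reg degree_eq_card[OF simple] by (simp add: N_def regular_def)
    moreover have "s \<in> N"
      using e us(2) by (simp add: N_def)
    ultimately have "card (N - {s}) = 1" by simp
    then obtain w where "N - {s} = {w}"
      by (rule card_1_singletonE)
    with \<open>s \<in> N\<close> have w: "N = {s, w}" by blast
    have "{u, w} \<in> E" "w < n"
      using w by (auto simp: N_def)
    then have "w \<notin> T" "w \<noteq> u"
      using NT[of w u] us(1) simple_graph_edge[OF simple, of u w]
      by (auto simp: R_def insert_commute)
    have "R \<noteq> {u}"
      using \<open>even (card R)\<close> by auto
    then obtain z' where "z' \<in> R" "z' \<noteq> u"
      using us(1) by blast
    \<comment> \<open>The vertex joining \<open>S\<close> must be \<open>w\<close> when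
      \<open>w\<close> is outside the pair; otherwise \<open>w\<close> is already in
      \<open>S\<close> and \<open>z\<close> only restores the excess 1.\<close>
    then obtain z where z: "z \<in> R" "z \<noteq> u" "w \<in> R \<Longrightarrow> z = w"
      using \<open>w \<noteq> u\<close> by metis
    have "sep_pair n (insert z S) (insert u T)"
      using ST z us(1) fin by (auto simp: sep_pair_def R_def)
    moreover have "v \<in> insert z S" if "x \<in> insert u T" "{x, v} \<in> E" for x v
    proof (cases "x = u")
      case True
      then have "v \<in> N"
        using that(2) simple_graph_edge[OF simple] by (auto simp: N_def)
      with w have "v = s \<or> v = w" by blast
      with \<open>s \<in> S\<close> \<open>w < n\<close> \<open>w \<notin> T\<close> z(3) show ?thesis
        by (auto simp: R_def)
    next
      case False
      with that NT show ?thesis by blast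
    qed
    ultimately have "P (insert u T)"
      unfolding P_def by blast
    then have "card (insert u T) \<le> card T"
      by (rule max)
    with us(1) fin show False
      by (simp add: R_def)
  qed
  \<comment> \<open>Both correction terms of \<open>card_isolating_edges\<close> vanish, leaving
    cost \<open>2 / 2 = 1\<close>.\<close>
  then have "arcs E R ({..<n} - R) = 0"
    by (subst arcs_eq_0_iff) (auto simp: R_def)
  moreover have "arcs E T T = 0"
    unfolding arcs_eq_0_iff[OF fin(2,2)] using NT ST by blast
  ultimately have "card (isolating_edges E S T) = 1"
    using card_isolating_edges[OF reg sep R_def] by simp
  then show ?thesis
    using mu_le_isolating_edges[OF simple sep] by simp
qed

text \<open>Taking \<open>S\<close> as the whole complement of \<open>T\<close> leaves
  \<open>R\<close> empty, so only edges inside \<open>T\<close> raise the cost above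
  \<open>k / 2\<close>.\<close>

lemma mu_le_span:
  assumes reg: "regular n k E" and T: "T \<subseteq> {..<n}" "n = 2 * card T + 1"
  shows "2 * mu n E \<le> k + arcs E T T"
proof -
  let ?S = "{..<n} - T"
  have "card ?S = n - card T"
    using T(1) by (simp add: card_Diff_subset finite_subset)
  then have sep: "sep_pair n ?S T"
    using T unfolding sep_pair_def by auto
  have "2 * card (isolating_edges E ?S T) = k + arcs E T T"
    using card_isolating_edges[OF reg sep refl] T(1) by (simp add: Un_absorb2 arcs_def)
  then show ?thesis
    using mu_le_isolating_edges[OF regular_simple[OF reg] sep] by linarith
qed

text \<open>It suffices that \<open>T\<close> spans at most one edge. For \<open>n = 5\<close> any
  two vertices do; for \<open>n = 7\<close> take vertex 0 with its two non-neighbours.\<close>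

lemma mu_four_regular:
  assumes reg: "regular n 4 E" and "n \<in> {5, 7}"
  shows "mu n E \<le> 3"
proof -
  note simple = regular_simple[OF reg]
  have loop: "{u} \<notin> E" for u
    using simple_graph_edge(3)[OF simple, of u u] by auto
  have "\<exists>T\<subseteq>{..<n}. n = 2 * card T + 1 \<and> arcs E T T \<le> 2"
  proof (cases "n = 5")
    case True
    then show ?thesis
      by (intro exI[of _ "{0, 1}"]) (auto simp: arcs_def loop simp del: sum_of_bool_eq)
  next
    case False
    with assms(2) have n: "n = 7" by simp
    define N where "N = {v\<in>{..<n}. {0, v} \<in> E}"
    have "card N = 4"
      using reg degree_eq_card[OF simple, of 0] n by (simp add: N_def regular_def)
    moreover have "0 \<notin> N"
      using loop[of 0] by (simp add: N_def)
    ultimately have "card ({..<n} - insert 0 N) = 2"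
      using n by (subst card_Diff_subset) (auto simp: N_def)
    then obtain a b where ab: "{..<n} - insert 0 N = {a, b}" "a \<noteq> b"
      by (auto simp: card_2_iff)
    then have "a \<in> {..<n} - insert 0 N" "b \<in> {..<n} - insert 0 N"
      by auto
    then have "a < n" "b < n" "a \<noteq> 0" "b \<noteq> 0" "{0, a} \<notin> E" "{0, b} \<notin> E"
      by (auto simp: N_def)
    then show ?thesis
      using ab(2) n by (intro exI[of _ "{0, a, b}"])
        (auto simp: arcs_def loop insert_commute simp del: sum_of_bool_eq)
  qed
  then obtain T where T: "T \<subseteq> {..<n}" "n = 2 * card T + 1" "arcs E T T \<le> 2"
    by blast
  show ?thesis
    using mu_le_span[OF reg T(1,2)] T(3) by linarith
qed

theorem theorem34:
  fixes n k :: nat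
  assumes "k < n" and "even (k * n)"
  shows "mu_bar n (\<lambda>_. k) =
           (if (k = 2 \<and> odd n) \<or> (k = 4 \<and> n \<in> {5, 7}) then k - 1 else k)"
proof -
  let ?m = "if exceptional n k then k - 1 else k"
  let ?M = "{mu n E | E. simple_graph n E \<and> (\<forall>v<n. degree E v = k)}"
  have le: "mu n E \<le> ?m" if "regular n k E" for E
    using mu_le_regular[OF that] mu_two_regular_odd[of n E] mu_four_regular[of n E] that assms(1)
    by (auto simp: exceptional_def)
  have "Max ?M = ?m"
  proof (rule Max_eqI)
    \<comment> \<open>The upper bound on \<open>mu\<close> already confines the values to a finite
      set.\<close>
    show "finite ?M"
      by (rule finite_subset[of _ "{..?m}"]) (use le in \<open>auto simp: regular_def\<close>)
    show "x \<le> ?m" if "x \<in> ?M" for x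
      using that le by (auto simp: regular_def)
    have "mu n (extremal n k) = ?m"
      using le[OF extremal_regular[OF assms]] mu_extremal_ge[OF assms] by (rule antisym)
    then show "?m \<in> ?M"
      using extremal_regular[OF assms] unfolding regular_def by force
  qed
  then show ?thesis
    by (simp add: mu_bar_def exceptional_def)
qed

end
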